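(* A countable group $G$ is elementary amenable if and only if there is no infinite descending sequence of subgroups of the form $$G=G_0\geq G_1\geq\cdots\geq G_n\geq\cdots$$ such that for all $n\geq 0$, $G_n\neq\{e\}$ and there is a finitely generated subgroup $K_n\leq G_n$ with $G_{n+1}=[K_n,K_n]\cap H_n$, where $H_n$ is the intersection of all normal subgroups of $K_n$ of index at most $n+1$ in $K_n$.
   Context: The class of elementary amenable groups is the smallest class of countable groups that contains all finite groups and all (countable) abelian groups and is closed under group extensions, countable increasing unions, taking subgroups, and taking quotients. The descending sequence is not required to be strictly descending. $[K,K]$ denotes the commutator subgroup of $K$. *)

theory Defs
  imports "HOL-Algebra.Generated_Groups" "HOL-Library.Countable_Set"
begin

text \<open>Every countable group is isomorphic to one whose elements are natural numbers, so the
  smallest class of countable groups with the closure properties below is formed over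
  the type \<^typ>\<open>nat monoid\<close>, up to isomorphism. A quotient \<open>G Mod N\<close> has
  elements of type \<^typ>\<open>nat set\<close> and therefore enters through an isomorphic copy \<open>Q\<close>;
  \<open>group Q\<close> has to be required separately since \<open>Q \<cong> G Mod N\<close> does not
  imply that \<open>Q\<close> is closed under its multiplication.\<close>

inductive elementary_amenable_nat :: "nat monoid \<Rightarrow> bool" where
  finite: "group G \<Longrightarrow> finite (carrier G) \<Longrightarrow> elementary_amenable_nat G"
| abelian: "comm_group G \<Longrightarrow> elementary_amenable_nat G"
| extension:
    "group G \<Longrightarrow> N \<lhd> G \<Longrightarrow> elementary_amenable_nat (G\<lparr>carrier := N\<rparr>) \<Longrightarrow>
     elementary_amenable_nat Q \<Longrightarrow> Q \<cong> G Mod N \<Longrightarrow> elementary_amenable_nat G"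
| increasing_union:
    "group G \<Longrightarrow> (\<And>n::nat. subgroup (A n) G) \<Longrightarrow> (\<And>n. A n \<subseteq> A (Suc n)) \<Longrightarrow>
     (\<And>n. elementary_amenable_nat (G\<lparr>carrier := A n\<rparr>)) \<Longrightarrow> carrier G = (\<Union>n. A n) \<Longrightarrow>
     elementary_amenable_nat G"
| subgroup:
    "elementary_amenable_nat G \<Longrightarrow> subgroup H G \<Longrightarrow> elementary_amenable_nat (G\<lparr>carrier := H\<rparr>)"
| quotient:
    "elementary_amenable_nat G \<Longrightarrow> N \<lhd> G \<Longrightarrow> group Q \<Longrightarrow> Q \<cong> G Mod N \<Longrightarrow>
     elementary_amenable_nat Q"
| isomorphic:
    "elementary_amenable_nat G \<Longrightarrow> group H \<Longrightarrow> H \<cong> G \<Longrightarrow> elementary_amenable_nat H"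

definition elementary_amenable :: "('a, 'b) monoid_scheme \<Rightarrow> bool" where
  "elementary_amenable G \<longleftrightarrow> group G \<and> (\<exists>H. elementary_amenable_nat H \<and> G \<cong> H)"

definition finitely_generated_subgroup :: "'a set \<Rightarrow> ('a, 'b) monoid_scheme \<Rightarrow> bool" where
  "finitely_generated_subgroup K G \<longleftrightarrow>
     subgroup K G \<and> (\<exists>X. finite X \<and> X \<subseteq> carrier G \<and> K = generate G X)"

text \<open>The intersection of all normal subgroups of \<open>K\<close> of index at most \<open>m\<close> in \<open>K\<close>. Finiteness of
  the set of cosets is explicit because \<^const>\<open>card\<close> is \<open>0\<close> on infinite sets.\<close>

definition normal_index_Inter :: "('a, 'b) monoid_scheme \<Rightarrow> 'a set \<Rightarrow> nat \<Rightarrow> 'a set" where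
  "normal_index_Inter G K m =
     \<Inter> {N. N \<lhd> G\<lparr>carrier := K\<rparr> \<and>
            finite (rcosets\<^bsub>G\<lparr>carrier := K\<rparr>\<^esub> N) \<and> card (rcosets\<^bsub>G\<lparr>carrier := K\<rparr>\<^esub> N) \<le> m}"

end

theory Submission
  imports Defs
begin

text \<open>
  Elementary amenability and the absence of infinite descents are compared through an inductive
  predicate. A descent step passes from \<open>S\<close> to \<open>[K, K] \<inter> H\<close>, where \<open>K \<le> S\<close> is finitely generated and
  \<open>H\<close> is the intersection of the normal subgroups of \<open>K\<close> of index at most some bound, a bound that grows by
  one with every step. The predicate \<open>descent_terminates G n S\<close> says that every sequence of steps from
  \<open>S\<close> whose first index bound is \<open>n + 1\<close> reaches the trivial group; by dependent choice it
  fails for \<open>n = 0\<close> and \<open>S = G\<close> exactly when there is an infinite sequence of nontrivial groups as in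
  the theorem (\<open>descent_terminates_iff_no_sequence\<close>).

  Termination implies elementary amenability by induction on the predicate
  (\<open>descent_terminates_imp_elementary_amenable_nat\<close>). A finitely generated group \<open>K\<close> has only finitely
  many subgroups of bounded index (\<open>finite_bounded_index_subgroups\<close>), so \<open>[K, K] \<inter> H\<close> has finite index in
  \<open>[K, K]\<close>, and \<open>K / [K, K]\<close> is abelian. Hence if all steps from \<open>S\<close> lead to elementary amenable groups,
  then all finitely generated \<open>K \<le> S\<close> are elementary amenable, and a countable \<open>S\<close> is an
  increasing union of such \<open>K\<close>.

  Conversely, the groups in which descents terminate for every initial bound form a class with all the
  closure properties that define elementary amenability
  (\<open>elementary_amenable_nat_descent_terminates\<close>). In an abelian group the first step is already trivial, in a
  finite group a step is trivial once the bound has reached the order of the group, and finitely generated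
  subgroups of an increasing union lie in one of its terms. Subgroups have fewer steps available. For an
  extension, homomorphisms map steps into steps (\<open>image_descent_step\<close>), so a descent first dies out
  in the quotient and from then on runs inside the kernel (\<open>descent_terminates_extension\<close>).

  Quotients need an argument of their own, because the image of a step can be smaller than the step taken in
  the quotient: the image of \<open>H\<close> need not contain every element of the intersection formed there.
  But the image of \<open>[K, K]\<close> is the whole commutator subgroup of the image of \<open>K\<close>, and the image of the step
  has finite index in it; since a finite extension does not spoil termination, termination passes from the
  image of the step to all of that commutator subgroup (\<open>descent_terminates_image\<close>).
\<close>

section \<open>Subgroups of finite index\<close>

lemma (in group) r_coset_step:
  assumes "subgroup N G" "g \<in> carrier G" "h \<in> carrier G" "x \<in> carrier G" "N #> g = N #> h"
  shows "N #> (g \<otimes> x) = N #> (h \<otimes> x)"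
  using assms coset_mult_assoc[OF subgroup.subset[OF assms(1)], symmetric] by simp

text \<open>The cosets of a subgroup of index at most \<open>m\<close> can be labelled by numbers below \<open>m\<close>. The label of the
  subgroup itself and the way in which the generators and their inverses permute the labels determine the label
  of the coset of every group element, and so the subgroup. There are only finitely many such data.\<close>
lemma (in group) finite_bounded_index_subgroups:
  assumes X: "finite X" "X \<subseteq> carrier G" and gen: "carrier G = generate G X"
  shows "finite {N. subgroup N G \<and> finite (rcosets N) \<and> card (rcosets N) \<le> m}" (is "finite ?\<N>")
proof -
  define Y where "Y = X \<union> m_inv G ` X"
  have Y: "finite Y" "Y \<subseteq> carrier G"
    using X by (auto simp: Y_def)
  have "\<exists>l. inj_on l (rcosets N) \<and> l ` (rcosets N) \<subseteq> {..<m}" if "N \<in> ?\<N>" for N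
  proof -
    from that have fin: "finite (rcosets N)" and le: "card (rcosets N) \<le> m"
      by simp_all
    from ex_bij_betw_finite_nat[OF fin] obtain l
      where "bij_betw l (rcosets N) {0..<card (rcosets N)}" ..
    then have "inj_on l (rcosets N)" "l ` (rcosets N) = {0..<card (rcosets N)}"
      by (simp_all only: bij_betw_def)
    moreover have "{0..<card (rcosets N)} \<subseteq> {..<m}"
      using le by auto
    ultimately show ?thesis
      by metis
  qed
  then have "\<forall>N \<in> ?\<N>. \<exists>l. inj_on l (rcosets N) \<and> l ` (rcosets N) \<subseteq> {..<m}"
    by blast
  from bchoice[OF this] obtain l where l: "\<And>N. N \<in> ?\<N> \<Longrightarrow> inj_on (l N) (rcosets N)"
      "\<And>N. N \<in> ?\<N> \<Longrightarrow> l N ` (rcosets N) \<subseteq> {..<m}"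
    by blast
  \<comment> \<open>The second component is a relation, not a function on labels, so that nothing has to be chosen. A triple
    \<open>(y, i, j)\<close> says that multiplication by \<open>y\<close> sends the coset labelled \<open>i\<close> to the one labelled \<open>j\<close>.\<close>
  define code where "code = (\<lambda>N. (l N N,
      {(y, i, j). y \<in> Y \<and> (\<exists>g \<in> carrier G. i = l N (N #> g) \<and> j = l N (N #> (g \<otimes> y)))}))"
  have rc: "N #> g \<in> rcosets N" if "N \<in> ?\<N>" "g \<in> carrier G" for N g
    using that by (blast intro: rcosetsI dest: subgroup.subset)
  have self: "N \<in> rcosets N" if "N \<in> ?\<N>" for N
    using that by (blast intro: subgroup.subgroup_in_rcosets is_group)
  have "code N \<in> {..<m} \<times> Pow (Y \<times> {..<m} \<times> {..<m})" if N: "N \<in> ?\<N>" for N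
  proof -
    have "l N (N #> g) < m" if "g \<in> carrier G" for g
      using l(2)[OF N] rc[OF N that] by blast
    moreover have "l N N < m"
      using l(2)[OF N] self[OF N] by blast
    ultimately show ?thesis
      using Y(2) by (auto simp: code_def)
  qed
  then have "code ` ?\<N> \<subseteq> {..<m} \<times> Pow (Y \<times> {..<m} \<times> {..<m})"
    by blast
  then have "finite (code ` ?\<N>)"
    by (rule finite_subset) (simp add: Y)
  moreover have "inj_on code ?\<N>"
  proof (rule inj_onI)
    fix N M assume N: "N \<in> ?\<N>" and M: "M \<in> ?\<N>" and eq: "code N = code M"
    have step: "l N (N #> (h \<otimes> y)) = l M (M #> (h \<otimes> y))"
      if y: "y \<in> Y" and h: "h \<in> carrier G" and lh: "l N (N #> h) = l M (M #> h)" for h y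
    proof -
      have "(y, l N (N #> h), l N (N #> (h \<otimes> y))) \<in> snd (code N)"
        using y h by (auto simp: code_def)
      then have "(y, l N (N #> h), l N (N #> (h \<otimes> y))) \<in> snd (code M)"
        by (simp add: eq)
      then obtain g where g: "g \<in> carrier G" "l N (N #> h) = l M (M #> g)"
          "l N (N #> (h \<otimes> y)) = l M (M #> (g \<otimes> y))"
        by (auto simp: code_def)
      have "M #> g = M #> h"
        using lh g(2) by (intro inj_onD[OF l(1)[OF M] _ rc[OF M] rc[OF M]]) (auto simp: g(1) h)
      then have "M #> (g \<otimes> y) = M #> (h \<otimes> y)"
        using M g(1) h y Y(2) by (intro r_coset_step) auto
      then show ?thesis
        using g(3) by simp
    qed
    \<comment> \<open>If the walks in both coset graphs are at the same label, they still are after following the word \<open>g\<close>.\<close>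
    have walk: "g \<in> carrier G \<and> (\<forall>h \<in> carrier G. l N (N #> h) = l M (M #> h) \<longrightarrow>
        l N (N #> (h \<otimes> g)) = l M (M #> (h \<otimes> g)))" if "g \<in> generate G X" for g
      using that
    proof induction
      case one
      show ?case by simp
    next
      case (incl x)
      then have "x \<in> Y" by (simp add: Y_def)
      then show ?case using step Y(2) by blast
    next
      case (inv x)
      then have "inv x \<in> Y" by (simp add: Y_def)
      then show ?case using step Y(2) by blast
    next
      case (eng g1 g2)
      then show ?case by (simp add: m_assoc[symmetric])
    qed
    have start: "l N (N #> \<one>) = l M (M #> \<one>)"
      using eq N M by (simp add: code_def coset_join2 subgroup.one_closed)
    have lab: "l N (N #> g) = l M (M #> g)" if "g \<in> carrier G" for g
      using walk[of g] start that by (auto simp: gen[symmetric])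
    have mem: "g \<in> N \<longleftrightarrow> l N (N #> g) = l N (N #> \<one>)" if "g \<in> carrier G" "N \<in> ?\<N>" for g N
    proof -
      have "l N (N #> g) = l N (N #> \<one>) \<longleftrightarrow> N #> g = N #> \<one>"
        using inj_on_eq_iff[OF l(1)[OF that(2)] rc[OF that(2) that(1)] rc[OF that(2) one_closed]] .
      also have "\<dots> \<longleftrightarrow> g \<in> N"
        using that by (metis (mono_tags, lifting) coset_join1 coset_join2 coset_mult_one mem_Collect_eq subgroup.subset)
      finally show ?thesis by simp
    qed
    have "g \<in> N \<longleftrightarrow> g \<in> M" if g: "g \<in> carrier G" for g
      using mem[OF g N] mem[OF g M] lab[OF g] start by simp
    moreover have "N \<subseteq> carrier G" "M \<subseteq> carrier G"
      using N M subgroup.subset by blast+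
    ultimately show "N = M"
      by blast
  qed
  ultimately show ?thesis
    by (rule finite_imageD)
qed

lemma (in group) Int_finite_index:
  assumes L: "subgroup L G" and N: "N \<lhd> G" "finite (rcosets N)"
  shows "L \<inter> N \<lhd> G\<lparr>carrier := L\<rparr>" "finite (rcosets\<^bsub>G\<lparr>carrier := L\<rparr>\<^esub> (L \<inter> N))"
proof -
  show "L \<inter> N \<lhd> G\<lparr>carrier := L\<rparr>"
    using normal_Int_subgroup[OF L N(1)] by (simp add: Int_commute)
  have sN: "subgroup N G" by (rule normal_imp_subgroup[OF N(1)])
  have "(L \<inter> N) #>\<^bsub>G\<lparr>carrier := L\<rparr>\<^esub> g = (N #> g) \<inter> L" if g: "g \<in> L" for g
  proof -
    have gc: "g \<in> carrier G" using g L subgroup.subset by blast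
    show ?thesis
    proof
      show "(L \<inter> N) #>\<^bsub>G\<lparr>carrier := L\<rparr>\<^esub> g \<subseteq> (N #> g) \<inter> L"
        using g by (auto simp: r_coset_def intro: subgroup.m_closed[OF L])
      show "(N #> g) \<inter> L \<subseteq> (L \<inter> N) #>\<^bsub>G\<lparr>carrier := L\<rparr>\<^esub> g"
      proof
        fix z assume "z \<in> (N #> g) \<inter> L"
        then obtain n where n: "n \<in> N" "z = n \<otimes> g" and z: "z \<in> L"
          by (auto simp: r_coset_def)
        have nc: "n \<in> carrier G" using n sN subgroup.subset by blast
        have "n = z \<otimes> inv g" using n gc nc by (simp add: m_assoc)
        then have "n \<in> L"
          using z g L by (simp add: subgroup.m_closed subgroup.m_inv_closed)
        then show "z \<in> (L \<inter> N) #>\<^bsub>G\<lparr>carrier := L\<rparr>\<^esub> g"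
          using n by (auto simp: r_coset_def)
      qed
    qed
  qed
  then have "rcosets\<^bsub>G\<lparr>carrier := L\<rparr>\<^esub> (L \<inter> N) \<subseteq> (\<lambda>C. C \<inter> L) ` (rcosets N)"
    using L subgroup.subset by (fastforce simp: RCOSETS_def)
  then show "finite (rcosets\<^bsub>G\<lparr>carrier := L\<rparr>\<^esub> (L \<inter> N))"
    using N(2) finite_surj by blast
qed

lemma (in group_hom) image_r_coset:
  assumes "M \<subseteq> carrier G" "g \<in> carrier G"
  shows "h ` (M #> g) = (h ` M) #>\<^bsub>H\<^esub> h g"
  using assms by (force simp: r_coset_def)

lemma (in group_hom) image_finite_index:
  assumes M: "M \<lhd> G" "finite (rcosets M)" and onto: "h ` carrier G = carrier H"
  shows "h ` M \<lhd> H" "finite (rcosets\<^bsub>H\<^esub> (h ` M))"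
proof -
  show "h ` M \<lhd> H"
    using normal.surj_hom_normal_subgroup[OF M(1) group_hom_axioms onto] .
  have "rcosets\<^bsub>H\<^esub> (h ` M) = (`) h ` (rcosets M)"
    using normal_imp_subgroup[OF M(1), THEN subgroup.subset]
    by (simp add: RCOSETS_def onto[symmetric] image_r_coset image_UN)
  then show "finite (rcosets\<^bsub>H\<^esub> (h ` M))"
    using M(2) by simp
qed

lemma (in group_hom) vimage_index_le:
  assumes N: "N \<lhd> H" "finite (rcosets\<^bsub>H\<^esub> N)"
  defines "N' \<equiv> {x \<in> carrier G. h x \<in> N}"
  shows "N' \<lhd> G" "finite (rcosets N')" "card (rcosets N') \<le> card (rcosets\<^bsub>H\<^esub> N)"
proof -
  have sN: "subgroup N H" by (rule normal_imp_subgroup[OF N(1)])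
  show nN': "N' \<lhd> G"
  proof (rule G.normal_invI)
    show "subgroup N' G"
      by (rule G.subgroupI)
        (auto simp: N'_def subgroup.one_closed[OF sN] subgroup.m_closed[OF sN] subgroup.m_inv_closed[OF sN])
    show "x \<otimes> n \<otimes> inv x \<in> N'" if "x \<in> carrier G" "n \<in> N'" for x n
      using that normal.inv_op_closed2[OF N(1), of "h x" "h n"] by (auto simp: N'_def)
  qed
  have sN': "subgroup N' G" by (rule normal_imp_subgroup[OF nN'])
  define \<phi> where "\<phi> C = N #>\<^bsub>H\<^esub> h (SOME g. g \<in> carrier G \<and> C = N' #> g)" for C
  have rep: "(SOME g. g \<in> carrier G \<and> C = N' #> g) \<in> carrier G \<and>
      C = N' #> (SOME g. g \<in> carrier G \<and> C = N' #> g)" if "C \<in> rcosets N'" for C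
    using that by (intro someI_ex[of "\<lambda>g. g \<in> carrier G \<and> C = N' #> g"]) (auto simp: RCOSETS_def)
  have sub: "\<phi> ` (rcosets N') \<subseteq> rcosets\<^bsub>H\<^esub> N"
  proof clarify
    fix C assume "C \<in> rcosets N'"
    from rep[OF this] show "\<phi> C \<in> rcosets\<^bsub>H\<^esub> N"
      unfolding \<phi>_def by (intro H.rcosetsI subgroup.subset[OF sN]) simp
  qed
  have inj: "inj_on \<phi> (rcosets N')"
  proof (rule inj_onI)
    fix C D assume "C \<in> rcosets N'" and "D \<in> rcosets N'" and eq: "\<phi> C = \<phi> D"
    have "\<exists>g \<in> carrier G. C = N' #> g \<and> \<phi> C = N #>\<^bsub>H\<^esub> h g" if "C \<in> rcosets N'" for C
      using rep[OF that] unfolding \<phi>_def by blast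
    note this[OF \<open>C \<in> rcosets N'\<close>] this[OF \<open>D \<in> rcosets N'\<close>]
    then obtain a b where a: "a \<in> carrier G" "C = N' #> a" "\<phi> C = N #>\<^bsub>H\<^esub> h a"
      and b: "b \<in> carrier G" "D = N' #> b" "\<phi> D = N #>\<^bsub>H\<^esub> h b"
      by (elim bexE conjE)
    have "h b \<in> N #>\<^bsub>H\<^esub> h a"
      using H.repr_independenceD[OF sN, of "h b" "h a"] a b eq by simp
    then obtain n where n: "n \<in> N" "h b = n \<otimes>\<^bsub>H\<^esub> h a"
      by (auto simp: r_coset_def)
    have nc: "n \<in> carrier H" using n sN subgroup.subset by blast
    have "h (b \<otimes> inv a) = n"
      using n nc a(1) b(1) by (simp add: H.m_assoc)
    then have "b \<otimes> inv a \<in> N'"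
      using n a(1) b(1) by (simp add: N'_def)
    moreover have "b = (b \<otimes> inv a) \<otimes> a"
      using a(1) b(1) by (simp add: G.m_assoc)
    ultimately have "b \<in> N' #> a"
      unfolding r_coset_def by blast
    then show "C = D"
      using a b G.repr_independence[OF _ _ sN'] by simp
  qed
  show "finite (rcosets N')"
    using inj_on_finite[OF inj sub N(2)] .
  show "card (rcosets N') \<le> card (rcosets\<^bsub>H\<^esub> N)"
    by (rule card_inj_on_le[OF inj sub N(2)])
qed

lemma (in group) rcosets_one: "rcosets {\<one>} = (\<lambda>x. {x}) ` carrier G"
  by (auto simp: RCOSETS_def r_coset_def)

section \<open>The descent step\<close>

definition descent_step :: "('a, 'b) monoid_scheme \<Rightarrow> 'a set \<Rightarrow> nat \<Rightarrow> 'a set" where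
  "descent_step G K m = derived G K \<inter> normal_index_Inter G K m"

lemma descent_step_le_derived: "descent_step G K m \<subseteq> derived G K"
  by (simp add: descent_step_def)

lemma (in group) descent_step_le:
  assumes "subgroup K G"
  shows "descent_step G K m \<subseteq> K"
  by (rule order_trans[OF descent_step_le_derived derived_incl[OF subset_refl assms]])

lemma (in group) subgroup_descent_step:
  assumes K: "subgroup K G"
  shows "subgroup (descent_step G K m) G"
proof -
  let ?\<N> = "{N. N \<lhd> G\<lparr>carrier := K\<rparr> \<and>
            finite (rcosets\<^bsub>G\<lparr>carrier := K\<rparr>\<^esub> N) \<and> card (rcosets\<^bsub>G\<lparr>carrier := K\<rparr>\<^esub> N) \<le> m}"
  have "subgroup (\<Inter> (insert (derived G K) ?\<N>)) G"
    by (rule subgroups_Inter)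
      (use K in \<open>auto intro: derived_is_subgroup[OF subgroup.subset] incl_subgroup normal_imp_subgroup\<close>)
  then show ?thesis
    by (simp add: descent_step_def normal_index_Inter_def)
qed

lemma descent_step_antimono:
  assumes "m \<le> m'"
  shows "descent_step G K m' \<subseteq> descent_step G K m"
  using assms by (auto simp: descent_step_def normal_index_Inter_def)

text \<open>A normal subgroup of \<open>h ` K\<close> pulls back to a normal subgroup of \<open>K\<close> of no larger index. So every subgroup
  that cuts down the step in \<open>H\<close> has a counterpart that cuts down the step in \<open>G\<close>. The inclusion can be strict since \<open>K\<close>
  may have further normal subgroups, not containing the kernel.\<close>
lemma (in group_hom) image_descent_step:
  assumes K: "subgroup K G"
  shows "h ` descent_step G K m \<subseteq> descent_step H (h ` K) m"
proof clarify
  interpret K: group_hom "G\<lparr>carrier := K\<rparr>" "H\<lparr>carrier := h ` K\<rparr>" h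
    by (rule induced_group_hom[OF K])
  fix x assume x: "x \<in> descent_step G K m"
  have xK: "x \<in> K"
    using x G.descent_step_le[OF K] by blast
  have "h x \<in> derived H (h ` K)"
    using x derived_img[OF subgroup.subset[OF K]] by (auto simp: descent_step_def)
  moreover have "h x \<in> N" if N: "N \<lhd> H\<lparr>carrier := h ` K\<rparr>"
      "finite (rcosets\<^bsub>H\<lparr>carrier := h ` K\<rparr>\<^esub> N)" "card (rcosets\<^bsub>H\<lparr>carrier := h ` K\<rparr>\<^esub> N) \<le> m" for N
  proof -
    note v = K.vimage_index_le[OF N(1,2)]
    have "x \<in> {x \<in> carrier (G\<lparr>carrier := K\<rparr>). h x \<in> N}"
      using x v(1,2) order_trans[OF v(3) N(3)]
      unfolding descent_step_def normal_index_Inter_def by blast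
    then show ?thesis by simp
  qed
  ultimately show "h x \<in> descent_step H (h ` K) m"
    by (simp add: descent_step_def normal_index_Inter_def)
qed

text \<open>Here the trivial subgroup is itself among the normal subgroups of small index.\<close>
lemma (in group) descent_step_finite:
  assumes K: "subgroup K G" "finite K" "card K \<le> m"
  shows "descent_step G K m = {\<one>}"
proof -
  interpret K: group "G\<lparr>carrier := K\<rparr>"
    by (rule subgroup_imp_group[OF K(1)])
  have rc: "rcosets\<^bsub>G\<lparr>carrier := K\<rparr>\<^esub> {\<one>} = (\<lambda>x. {x}) ` K"
    using K.rcosets_one by simp
  have "descent_step G K m \<subseteq> {\<one>}"
    using K.one_is_normal K(2,3) unfolding descent_step_def normal_index_Inter_def
    by (intro le_infI2 Inter_lower) (simp add: rc card_image)
  then show ?thesis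
    using subgroup.one_closed[OF subgroup_descent_step[OF K(1)]] by blast
qed

text \<open>The step is cut out of \<open>[K, K]\<close> by finitely many subgroups of finite index in \<open>K\<close>; they are removed one at
  a time, each time at the price of one extension by a finite group. This is how a property that survives
  finite extensions is carried from the step back to \<open>[K, K]\<close>, both for elementary amenability and for
  termination in a quotient.\<close>
lemma (in group) finite_index_descent:
  assumes K: "finitely_generated_subgroup K G"
    and closed: "\<And>L M. subgroup L G \<Longrightarrow> L \<subseteq> K \<Longrightarrow> M \<lhd> G\<lparr>carrier := L\<rparr> \<Longrightarrow>
      finite (rcosets\<^bsub>G\<lparr>carrier := L\<rparr>\<^esub> M) \<Longrightarrow> P M \<Longrightarrow> P L"
    and P: "P (descent_step G K m)"
  shows "P (derived G K)"
proof -
  have sK: "subgroup K G"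
    using K by (simp add: finitely_generated_subgroup_def)
  obtain X where X: "finite X" "X \<subseteq> carrier G" "K = generate G X"
    using K by (auto simp: finitely_generated_subgroup_def)
  interpret K: group "G\<lparr>carrier := K\<rparr>"
    by (rule subgroup_imp_group[OF sK])
  have XK: "X \<subseteq> K"
    using X by (auto intro: generate.incl)
  define F where "F = {N. N \<lhd> G\<lparr>carrier := K\<rparr> \<and>
      finite (rcosets\<^bsub>G\<lparr>carrier := K\<rparr>\<^esub> N) \<and> card (rcosets\<^bsub>G\<lparr>carrier := K\<rparr>\<^esub> N) \<le> m}"
  have "finite {N. subgroup N (G\<lparr>carrier := K\<rparr>) \<and>
      finite (rcosets\<^bsub>G\<lparr>carrier := K\<rparr>\<^esub> N) \<and> card (rcosets\<^bsub>G\<lparr>carrier := K\<rparr>\<^esub> N) \<le> m}"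
    by (rule K.finite_bounded_index_subgroups[OF X(1)])
      (use XK X(3) generate_consistent[OF XK sK] in simp_all)
  then have "finite F"
    by (rule rev_finite_subset) (auto simp: F_def normal_imp_subgroup)
  have "P (derived G K \<inter> \<Inter> E) \<Longrightarrow> P (derived G K)" if "finite E" "E \<subseteq> F" for E
    using that
  proof (induction E rule: finite_induct)
    case empty
    then show ?case by simp
  next
    case (insert N E)
    have N: "N \<lhd> G\<lparr>carrier := K\<rparr>" "finite (rcosets\<^bsub>G\<lparr>carrier := K\<rparr>\<^esub> N)"
      using insert.prems by (auto simp: F_def)
    define L where "L = derived G K \<inter> \<Inter> E"
    have "subgroup (\<Inter> (insert (derived G K) E)) G"
      by (rule subgroups_Inter)
        (use sK insert.prems in \<open>auto simp: F_def intro: derived_is_subgroup[OF subgroup.subset]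
          incl_subgroup normal_imp_subgroup\<close>)
    then have L: "subgroup L G"
      by (simp add: L_def)
    have LK: "L \<subseteq> K"
      using derived_incl[OF subset_refl sK] by (auto simp: L_def)
    note int = K.Int_finite_index[OF subgroup_incl[OF L sK LK] N, simplified]
    have "L \<inter> N = derived G K \<inter> \<Inter> (insert N E)"
      by (auto simp: L_def)
    then have "P (L \<inter> N)"
      using insert.prems by simp
    then have "P L"
      using closed[OF L LK int] by simp
    then show ?case
      using insert by (simp add: L_def)
  qed
  from this[OF \<open>finite F\<close> subset_refl] P show ?thesis
    by (simp add: descent_step_def normal_index_Inter_def F_def)
qed

section \<open>Terminating descents\<close>

text \<open>The number \<open>n\<close> counts the steps made so far, so that the next one uses the index bound \<open>n + 1\<close>. The rule
  \<open>trivial\<close> is a base case that \<open>step\<close> does not supply: the trivial group only steps to itself, and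
  a descent is considered finished there.\<close>
inductive descent_terminates :: "('a, 'b) monoid_scheme \<Rightarrow> nat \<Rightarrow> 'a set \<Rightarrow> bool"
  for G :: "('a, 'b) monoid_scheme" where
  trivial: "descent_terminates G n {\<one>\<^bsub>G\<^esub>}"
| step: "(\<And>K. finitely_generated_subgroup K G \<Longrightarrow> K \<subseteq> S \<Longrightarrow>
      descent_terminates G (Suc n) (descent_step G K (Suc n))) \<Longrightarrow> descent_terminates G n S"

lemma (in group) descent_terminates_subgroup:
  assumes "descent_terminates G n S" "subgroup T G" "T \<subseteq> S"
  shows "descent_terminates G n T"
  using assms(1)
proof cases
  case trivial
  then have "T = {\<one>}"
    using assms(2,3) subgroup.one_closed by blast
  then show ?thesis by (simp add: descent_terminates.trivial)
next
  case step
  show ?thesis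
    by (rule descent_terminates.step) (use step assms(3) in blast)
qed

text \<open>A larger bound admits more normal subgroups and makes each step smaller.\<close>
lemma (in group) descent_terminates_mono:
  assumes "descent_terminates G n S" "n \<le> n'"
  shows "descent_terminates G n' S"
  using assms
proof (induction arbitrary: n')
  case (trivial n)
  show ?case by (rule descent_terminates.trivial)
next
  case (step S n)
  show ?case
  proof (rule descent_terminates.step)
    fix K assume K: "finitely_generated_subgroup K G" "K \<subseteq> S"
    have "descent_terminates G (Suc n') (descent_step G K (Suc n))"
      using step K by simp
    moreover have "subgroup (descent_step G K (Suc n')) G"
      using K by (simp add: finitely_generated_subgroup_def subgroup_descent_step)
    moreover have "descent_step G K (Suc n') \<subseteq> descent_step G K (Suc n)"
      using step.prems by (simp add: descent_step_antimono)
    ultimately show "descent_terminates G (Suc n') (descent_step G K (Suc n'))"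
      by (rule descent_terminates_subgroup)
  qed
qed

text \<open>The steps made while the bound is still below the order of the group stay inside the group; as soon as it
  has reached the order, the next step is trivial.\<close>
lemma (in group) descent_terminates_finite:
  assumes "subgroup S G" "finite S"
  shows "descent_terminates G n S"
proof -
  \<comment> \<open>The number \<open>d\<close> bounds the steps left until the index bound reaches the order.\<close>
  have "card T \<le> n + d \<Longrightarrow> subgroup T G \<Longrightarrow> finite T \<Longrightarrow> descent_terminates G n T" for d n T
  proof (induction d arbitrary: n T)
    case 0
    show ?case
    proof (rule descent_terminates.step)
      fix K assume K: "finitely_generated_subgroup K G" "K \<subseteq> T"
      then have "card K \<le> card T" "finite K" "subgroup K G"
        using 0 by (auto simp: finitely_generated_subgroup_def card_mono finite_subset)
      then have "descent_step G K (Suc n) = {\<one>}"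
        using 0 by (intro descent_step_finite) auto
      then show "descent_terminates G (Suc n) (descent_step G K (Suc n))"
        by (simp add: descent_terminates.trivial)
    qed
  next
    case (Suc d)
    show ?case
    proof (rule descent_terminates.step)
      fix K assume K: "finitely_generated_subgroup K G" "K \<subseteq> T"
      then have "subgroup K G"
        by (simp add: finitely_generated_subgroup_def)
      moreover have "descent_terminates G (Suc n) T"
        using Suc by simp
      ultimately show "descent_terminates G (Suc n) (descent_step G K (Suc n))"
        using K(2) descent_step_le by (blast intro: descent_terminates_subgroup subgroup_descent_step)
    qed
  qed
  from this[of S n "card S"] assms show ?thesis by simp
qed

lemma (in group) descent_terminates_abelian:
  assumes "derived G S \<subseteq> {\<one>}"
  shows "descent_terminates G n S"
proof (rule descent_terminates.step)
  fix K assume K: "finitely_generated_subgroup K G" "K \<subseteq> S"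
  then have "subgroup (descent_step G K (Suc n)) G"
    by (simp add: finitely_generated_subgroup_def subgroup_descent_step)
  moreover have "descent_step G K (Suc n) \<subseteq> {\<one>}"
    by (rule order_trans[OF descent_step_le_derived order_trans[OF mono_derived[OF K(2)] assms]])
  ultimately have "descent_step G K (Suc n) = {\<one>}"
    using subgroup.one_closed by blast
  then show "descent_terminates G (Suc n) (descent_step G K (Suc n))"
    by (simp add: descent_terminates.trivial)
qed

lemma finite_subset_incseq:
  assumes "finite X" "X \<subseteq> (\<Union>i::nat. A i)" "\<And>i. A i \<subseteq> A (Suc i)"
  obtains i where "X \<subseteq> A i"
proof -
  have mono: "A i \<subseteq> A j" if "i \<le> j" for i j
    using lift_Suc_mono_le[of A i j] assms(3) that by blast
  from assms(1,2) have "\<exists>i. X \<subseteq> A i"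
  proof (induction X)
    case (insert x X)
    then obtain i j where "X \<subseteq> A i" "x \<in> A j" by auto
    then have "insert x X \<subseteq> A (max i j)"
      using mono[of i "max i j"] mono[of j "max i j"] by auto
    then show ?case ..
  qed simp
  then show ?thesis using that by blast
qed

lemma (in group) descent_terminates_Union:
  assumes A: "\<And>i::nat. subgroup (A i) G" "\<And>i. A i \<subseteq> A (Suc i)"
    and A_term: "\<And>i. descent_terminates G n (A i)"
  shows "descent_terminates G n (\<Union>i. A i)"
proof (rule descent_terminates.step)
  fix K assume K: "finitely_generated_subgroup K G" "K \<subseteq> (\<Union>i. A i)"
  then obtain X where X: "finite X" "X \<subseteq> carrier G" "K = generate G X"
    by (auto simp: finitely_generated_subgroup_def)
  then have "X \<subseteq> (\<Union>i. A i)"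
    using K(2) by (auto intro: generate.incl)
  then obtain i where i: "X \<subseteq> A i"
    using finite_subset_incseq[of X A] X(1) A(2) by blast
  have KA: "K \<subseteq> A i"
    using generate_subgroup_incl[OF i A(1)] X(3) by simp
  have sK: "subgroup K G"
    using K(1) by (simp add: finitely_generated_subgroup_def)
  from A_term[of i] show "descent_terminates G (Suc n) (descent_step G K (Suc n))"
  proof cases
    case trivial
    have "descent_terminates G (Suc n) (A i)"
      by (rule descent_terminates_mono[OF A_term]) simp
    with KA show ?thesis
      using descent_step_le[OF sK]
      by (blast intro: descent_terminates_subgroup subgroup_descent_step[OF sK])
  next
    case step
    then show ?thesis using K(1) KA by blast
  qed
qed

text \<open>A descent from \<open>S\<close> is mapped by \<open>f\<close> below a descent from \<open>T\<close>, which becomes trivial after finitely many steps.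
  At that moment the descent in \<open>G\<close> has entered the kernel, where it terminates for every bound from \<open>n\<close> on.
  The homomorphism is defined on a subgroup \<open>A\<close> only, and \<open>f ` S\<close> is merely contained in \<open>T\<close>, because
  only this inclusion is preserved by a step.\<close>
lemma (in group) descent_terminates_extension:
  assumes A: "subgroup A G" and f: "group_hom (G\<lparr>carrier := A\<rparr>) Q f"
    and T: "descent_terminates Q n T"
    and ker: "descent_terminates G n {x \<in> A. f x = \<one>\<^bsub>Q\<^esub>}"
    and S: "subgroup S G" "S \<subseteq> A" "f ` S \<subseteq> T"
  shows "descent_terminates G n S"
  using T ker S
proof (induction arbitrary: S)
  case (trivial n)
  then have "S \<subseteq> {x \<in> A. f x = \<one>\<^bsub>Q\<^esub>}"
    by auto
  with trivial(1,2) show ?case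
    by (rule descent_terminates_subgroup)
next
  case (step T n)
  interpret f: group_hom "G\<lparr>carrier := A\<rparr>" Q f by (rule f)
  show ?case
  proof (rule descent_terminates.step)
    fix K assume K: "finitely_generated_subgroup K G" "K \<subseteq> S"
    then obtain X where X: "finite X" "X \<subseteq> carrier G" "K = generate G X" and sK: "subgroup K G"
      by (auto simp: finitely_generated_subgroup_def)
    have KA: "K \<subseteq> A" using K(2) step.prems(3) by blast
    have XA: "X \<subseteq> A" using X(3) KA by (auto intro: generate.incl)
    have sKA: "subgroup K (G\<lparr>carrier := A\<rparr>)"
      by (rule subgroup_incl[OF sK A KA])
    have "f ` K = generate Q (f ` X)"
      using f.generate_img[of X] XA generate_consistent[OF XA A] X(3) by simp
    moreover have "f ` X \<subseteq> carrier Q"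
      using XA by auto
    ultimately have "finitely_generated_subgroup (f ` K) Q"
      using X(1) f.subgroup_img_is_subgroup[OF sKA]
      unfolding finitely_generated_subgroup_def by (intro conjI exI[of _ "f ` X"]) auto
    moreover have "f ` K \<subseteq> T"
      using K(2) step.prems(4) by blast
    moreover have "descent_terminates G (Suc n) {x \<in> A. f x = \<one>\<^bsub>Q\<^esub>}"
      by (rule descent_terminates_mono[OF step.prems(1)]) simp
    moreover have "descent_step (G\<lparr>carrier := A\<rparr>) K (Suc n) = descent_step G K (Suc n)"
      by (simp add: descent_step_def normal_index_Inter_def derived_consistent[OF KA A])
    then have "f ` descent_step G K (Suc n) \<subseteq> descent_step Q (f ` K) (Suc n)"
      using f.image_descent_step[OF sKA, of "Suc n"] by simp
    moreover have "descent_step G K (Suc n) \<subseteq> A"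
      using descent_step_le[OF sK] KA by blast
    ultimately show "descent_terminates G (Suc n) (descent_step G K (Suc n))"
      by (intro step.IH[of "f ` K" "descent_step G K (Suc n)"] subgroup_descent_step[OF sK])
  qed
qed

lemma (in group) descent_terminates_factor:
  assumes S: "subgroup S G" and M: "M \<lhd> G\<lparr>carrier := S\<rparr>"
    and Mod: "descent_terminates (G\<lparr>carrier := S\<rparr> Mod M) n (carrier (G\<lparr>carrier := S\<rparr> Mod M))"
    and M_term: "descent_terminates G n M"
  shows "descent_terminates G n S"
proof -
  let ?S = "G\<lparr>carrier := S\<rparr>"
  interpret S: group ?S by (rule subgroup_imp_group[OF S])
  interpret M: normal M ?S by (rule M)
  interpret Q: group "?S Mod M" by (rule M.factorgroup_is_group)
  have hom: "group_hom ?S (?S Mod M) (\<lambda>x. M #>\<^bsub>?S\<^esub> x)"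
    by unfold_locales (rule M.r_coset_hom_Mod)
  interpret f: group_hom ?S "?S Mod M" "\<lambda>x. M #>\<^bsub>?S\<^esub> x" by (rule hom)
  have ker: "{x \<in> S. M #>\<^bsub>?S\<^esub> x = \<one>\<^bsub>?S Mod M\<^esub>} = M"
    using S.coset_join1[OF _ _ M.subgroup_axioms] S.coset_join2[OF _ M.subgroup_axioms] M.subset
    by auto
  have "descent_terminates G n {x \<in> S. M #>\<^bsub>?S\<^esub> x = \<one>\<^bsub>?S Mod M\<^esub>}"
    unfolding ker by (rule M_term)
  moreover have "(\<lambda>x. M #>\<^bsub>?S\<^esub> x) ` S \<subseteq> carrier (?S Mod M)"
    using f.hom_closed by (simp add: image_subset_iff)
  ultimately show ?thesis
    by (rule descent_terminates_extension[OF S hom Mod _ S subset_refl])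
qed

lemma (in group) descent_terminates_finite_index:
  assumes S: "subgroup S G"
    and M: "M \<lhd> G\<lparr>carrier := S\<rparr>" "finite (rcosets\<^bsub>G\<lparr>carrier := S\<rparr>\<^esub> M)"
    and M_term: "descent_terminates G n M"
  shows "descent_terminates G n S"
proof (rule descent_terminates_factor[OF S M(1) _ M_term])
  interpret Q: group "G\<lparr>carrier := S\<rparr> Mod M"
    by (rule normal.factorgroup_is_group[OF M(1)])
  show "descent_terminates (G\<lparr>carrier := S\<rparr> Mod M) n (carrier (G\<lparr>carrier := S\<rparr> Mod M))"
    by (rule Q.descent_terminates_finite[OF Q.subgroup_self]) (use M(2) in \<open>simp add: FactGroup_def\<close>)
qed

text \<open>A finitely generated \<open>K \<le> h ` S\<close> is the image of a finitely generated \<open>K' \<le> S\<close>. The induction hypothesis is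
  about the image of the step of \<open>K'\<close>, which may be too small. It has finite index in \<open>h ` [K', K'] = [K, K]\<close>,
  so termination extends to \<open>[K, K]\<close> and thus to the step of \<open>K\<close>.\<close>
lemma (in group_hom) descent_terminates_image:
  assumes "descent_terminates G n S" "subgroup S G" "subgroup T H" "T \<subseteq> h ` S"
  shows "descent_terminates H n T"
  using assms
proof (induction arbitrary: T)
  case (trivial n)
  then have "T = {\<one>\<^bsub>H\<^esub>}"
    using subgroup.one_closed[OF trivial.prems(2)] by auto
  then show ?case by (simp add: descent_terminates.trivial)
next
  case (step S n)
  show ?case
  proof (rule descent_terminates.step)
    fix K assume K: "finitely_generated_subgroup K H" "K \<subseteq> T"
    then obtain X where X: "finite X" "X \<subseteq> carrier H" "K = generate H X" and sK: "subgroup K H"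
      by (auto simp: finitely_generated_subgroup_def)
    have "X \<subseteq> h ` S"
      using X(3) K(2) step.prems(3) by (auto intro: generate.incl)
    from finite_subset_image[OF X(1) this] obtain X'
      where X': "finite X'" "X' \<subseteq> S" "X = h ` X'"
      by (elim exE conjE)
    have X'c: "X' \<subseteq> carrier G"
      using X'(2) subgroup.subset[OF step.prems(1)] by blast
    define K' where "K' = generate G X'"
    have sK': "subgroup K' G"
      unfolding K'_def by (rule G.generate_is_subgroup[OF X'c])
    have fg: "finitely_generated_subgroup K' G"
      using X'(1) X'c sK' unfolding finitely_generated_subgroup_def K'_def by blast
    have K'S: "K' \<subseteq> S"
      unfolding K'_def by (rule G.generate_subgroup_incl[OF X'(2) step.prems(1)])
    have KK': "K = h ` K'"
      using generate_img[OF X'c] X(3) X'(3) by (simp add: K'_def)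
    have "descent_terminates H (Suc n) (h ` derived G K')"
    proof (rule G.finite_index_descent[OF fg])
      show "descent_terminates H (Suc n) (h ` descent_step G K' (Suc n))"
        by (rule step.IH[OF fg K'S])
          (simp_all add: G.subgroup_descent_step sK' subgroup_img_is_subgroup)
      fix L M assume L: "subgroup L G" "L \<subseteq> K'" and M: "M \<lhd> G\<lparr>carrier := L\<rparr>"
        "finite (rcosets\<^bsub>G\<lparr>carrier := L\<rparr>\<^esub> M)" and t: "descent_terminates H (Suc n) (h ` M)"
      interpret L: group_hom "G\<lparr>carrier := L\<rparr>" "H\<lparr>carrier := h ` L\<rparr>" h
        by (rule induced_group_hom[OF L(1)])
      show "descent_terminates H (Suc n) (h ` L)"
        using H.descent_terminates_finite_index[OF subgroup_img_is_subgroup[OF L(1)]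
            L.image_finite_index[OF M] t] by simp
    qed
    then have "descent_terminates H (Suc n) (derived H K)"
      using derived_img[of K'] subgroup.subset[OF sK'] KK' by simp
    then show "descent_terminates H (Suc n) (descent_step H K (Suc n))"
      by (rule H.descent_terminates_subgroup[OF _ H.subgroup_descent_step[OF sK]
          descent_step_le_derived])
  qed
qed

section \<open>Descents in elementary amenable groups\<close>

lemma elementary_amenable_nat_group: "elementary_amenable_nat G \<Longrightarrow> group G"
  by (induction rule: elementary_amenable_nat.induct)
    (simp_all add: comm_group.axioms(2) group.subgroup_imp_group)

text \<open>The inclusion of \<open>A\<close> is a homomorphism with image \<open>A\<close> and trivial kernel. The image lemma gives one direction
  and the extension lemma the other.\<close>
lemma (in group) descent_terminates_restrict:
  assumes A: "subgroup A G"
  shows "descent_terminates (G\<lparr>carrier := A\<rparr>) n A \<longleftrightarrow> descent_terminates G n A"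
proof
  interpret A: group "G\<lparr>carrier := A\<rparr>" by (rule subgroup_imp_group[OF A])
  have hom: "group_hom (G\<lparr>carrier := A\<rparr>) G id"
    by (rule canonical_inj_is_hom[OF A])
  have sA: "subgroup A (G\<lparr>carrier := A\<rparr>)"
    using A.subgroup_self by simp
  show "descent_terminates G n A" if "descent_terminates (G\<lparr>carrier := A\<rparr>) n A"
    using group_hom.descent_terminates_image[OF hom that sA A] by simp
  have ker: "{x \<in> A. id x = \<one>} = {\<one>\<^bsub>G\<lparr>carrier := A\<rparr>\<^esub>}"
    using subgroup.one_closed[OF A] by auto
  have "descent_terminates (G\<lparr>carrier := A\<rparr>) n {x \<in> A. id x = \<one>}"
    unfolding ker by (rule descent_terminates.trivial)
  then show "descent_terminates (G\<lparr>carrier := A\<rparr>) n A" if "descent_terminates G n A"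
    using A.descent_terminates_extension[OF sA _ that _ sA] hom by simp
qed

lemma iso_descent_terminates:
  assumes "group G" "group H" "G \<cong> H" "descent_terminates G n (carrier G)"
  shows "descent_terminates H n (carrier H)"
proof -
  obtain f where f: "f \<in> iso G H"
    using assms(3) by (auto simp: is_iso_def)
  interpret group_hom G H f
    using assms(1,2) f by (simp add: group_hom_def group_hom_axioms_def iso_def)
  have "f ` carrier G = carrier H"
    using f by (auto simp: iso_def bij_betw_def)
  then show ?thesis
    using descent_terminates_image[OF assms(4) G.subgroup_self H.subgroup_self] by simp
qed

lemma elementary_amenable_nat_descent_terminates:
  assumes "elementary_amenable_nat G"
  shows "descent_terminates G n (carrier G)"
  using assms
proof (induction arbitrary: n rule: elementary_amenable_nat.induct)
  case (finite G)
  then show ?case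
    by (simp add: group.descent_terminates_finite group.subgroup_self)
next
  case (abelian G)
  interpret comm_group G by (rule abelian)
  show ?case
    by (rule descent_terminates_abelian) (simp add: derived_eq_singleton)
next
  case (extension G N Q)
  interpret normal N G by (rule extension)
  have Q: "group Q" by (rule elementary_amenable_nat_group) fact
  have "descent_terminates (G Mod N) n (carrier (G Mod N))"
    by (rule iso_descent_terminates[OF Q factorgroup_is_group]) fact+
  moreover have "descent_terminates G n N"
    using descent_terminates_restrict[OF subgroup_axioms] extension.IH(1) by simp
  ultimately show ?case
    using descent_terminates_factor[OF subgroup_self, of N] normal_axioms by simp
next
  case (increasing_union G A)
  interpret group G by fact
  show ?case
    unfolding increasing_union.hyps
    by (rule descent_terminates_Union)
      (use increasing_union in \<open>auto simp: descent_terminates_restrict\<close>)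
next
  case (subgroup G H)
  interpret group G by (rule elementary_amenable_nat_group) fact
  have "descent_terminates G n H"
    using descent_terminates_subgroup[OF subgroup.IH] subgroup.hyps subgroup.subset by blast
  then show ?case
    using descent_terminates_restrict subgroup.hyps by simp
next
  case (quotient G N Q)
  interpret normal N G by (rule quotient)
  interpret M: group "G Mod N" by (rule factorgroup_is_group)
  interpret group_hom G "G Mod N" "\<lambda>x. N #>\<^bsub>G\<^esub> x"
    by unfold_locales (rule r_coset_hom_Mod)
  have "descent_terminates (G Mod N) n (carrier (G Mod N))"
    by (rule descent_terminates_image[OF quotient.IH])
      (simp_all add: carrier_FactGroup subgroup_self M.subgroup_self[unfolded carrier_FactGroup])
  then show ?case
    using iso_descent_terminates[OF M.is_group quotient.hyps(3)] group.iso_sym[OF quotient.hyps(3,4)] by blast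
next
  case (isomorphic G H)
  then show ?case
    using iso_descent_terminates[of G H n] elementary_amenable_nat_group group.iso_sym by blast
qed


section \<open>Elementary amenability from terminating descents\<close>

lemma (in group) ex_nat_copy:
  assumes "countable (carrier G)"
  obtains H :: "nat monoid" where "group H" "G \<cong> H"
proof -
  let ?f = "to_nat_on (carrier G)" and ?g = "from_nat_into (carrier G)"
  define H0 :: "nat monoid" where
    "H0 = \<lparr>carrier = UNIV, monoid.mult = (\<lambda>x y. ?f (?g x \<otimes> ?g y)), one = 0\<rparr>"
  define H where "H = H0\<lparr>carrier := ?f ` carrier G, one := ?f \<one>\<rparr>"
  have hom: "?f \<in> hom G H0"
    using assms by (auto simp: hom_def H0_def)
  have "group H"
    unfolding H_def by (rule hom_imp_img_group[OF hom])
  moreover have "?f \<in> iso G H"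
    using assms by (auto simp: iso_def hom_def H_def H0_def bij_betw_def inj_on_to_nat_on)
  ultimately show ?thesis
    using that by (auto simp: is_iso_def)
qed

text \<open>The two kinds of quotient for which elementary amenability is immediate once the group of cosets has been
  replaced by a copy on the natural numbers.\<close>
lemma elementary_amenable_nat_extension:
  fixes G :: "nat monoid"
  assumes G: "group G" and N: "N \<lhd> G" "elementary_amenable_nat (G\<lparr>carrier := N\<rparr>)"
    and Q: "finite (carrier (G Mod N)) \<or> comm_group (G Mod N)"
  shows "elementary_amenable_nat G"
proof -
  interpret normal N G by (rule N(1))
  interpret Q: group "G Mod N" by (rule factorgroup_is_group)
  have "countable (carrier (G Mod N))"
    by (simp add: carrier_FactGroup)
  then obtain H :: "nat monoid" where H: "group H" "G Mod N \<cong> H"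
    by (rule Q.ex_nat_copy)
  have "elementary_amenable_nat H"
    using Q
  proof
    assume "finite (carrier (G Mod N))"
    then have "finite (carrier H)"
      using H(2) by (auto simp: is_iso_def iso_def dest: bij_betw_finite)
    with H(1) show ?thesis by (rule elementary_amenable_nat.finite)
  next
    assume "comm_group (G Mod N)"
    then have "comm_group H"
      using comm_group.iso_imp_comm_group[OF _ H(2)] H(1) by (simp add: group.is_monoid)
    then show ?thesis by (rule elementary_amenable_nat.abelian)
  qed
  then show ?thesis
    by (rule elementary_amenable_nat.extension[OF G N _ Q.iso_sym[OF H(2)]])
qed

text \<open>Countability enters here: the elements of \<open>S\<close> below \<open>i\<close> are finitely many, and the subgroups that they
  generate increase to \<open>S\<close>.\<close>
lemma elementary_amenable_nat_locally:
  fixes G :: "nat monoid"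
  assumes G: "group G" and S: "subgroup S G"
    and fg: "\<And>K. finitely_generated_subgroup K G \<Longrightarrow> K \<subseteq> S \<Longrightarrow> elementary_amenable_nat (G\<lparr>carrier := K\<rparr>)"
  shows "elementary_amenable_nat (G\<lparr>carrier := S\<rparr>)"
proof -
  interpret group G by (rule G)
  define A where "A i = generate G (S \<inter> {..<i})" for i
  have SG: "S \<inter> {..<i} \<subseteq> carrier G" for i
    using subgroup.subset[OF S] by blast
  have sA: "subgroup (A i) G" for i
    unfolding A_def by (rule generate_is_subgroup[OF SG])
  have AS: "A i \<subseteq> S" for i
    unfolding A_def by (rule generate_subgroup_incl[OF _ S]) simp
  have "finitely_generated_subgroup (A i) G" for i
    unfolding finitely_generated_subgroup_def
    using SG sA by (intro conjI exI[of _ "S \<inter> {..<i}"]) (simp_all add: A_def)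
  then have EA: "elementary_amenable_nat (G\<lparr>carrier := A i\<rparr>)" for i
    using fg AS by blast
  have "x \<in> A (Suc x)" if "x \<in> S" for x
    using that by (auto simp: A_def intro: generate.incl)
  then have S_Union: "S = (\<Union>i. A i)"
    using AS by blast
  show ?thesis
  proof (rule elementary_amenable_nat.increasing_union[OF subgroup_imp_group[OF S]])
    show "subgroup (A i) (G\<lparr>carrier := S\<rparr>)" for i
      by (rule subgroup_incl[OF sA S AS])
    show "A i \<subseteq> A (Suc i)" for i
      unfolding A_def by (rule mono_generate) auto
    show "elementary_amenable_nat (G\<lparr>carrier := S, carrier := A i\<rparr>)" for i
      using EA by simp
    show "carrier (G\<lparr>carrier := S\<rparr>) = (\<Union>i. A i)"
      by (simp add: S_Union)
  qed
qed

lemma descent_terminates_imp_elementary_amenable_nat: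
  fixes G :: "nat monoid"
  assumes G: "group G" and "descent_terminates G n S" "subgroup S G"
  shows "elementary_amenable_nat (G\<lparr>carrier := S\<rparr>)"
  using assms(2,3)
proof induction
  case (trivial n)
  then show ?case
    by (intro elementary_amenable_nat.finite group.subgroup_imp_group G) simp_all
next
  case (step S n)
  interpret group G by (rule G)
  show ?case
  proof (rule elementary_amenable_nat_locally[OF G step.prems])
    fix K assume K: "finitely_generated_subgroup K G" "K \<subseteq> S"
    then have sK: "subgroup K G"
      by (simp add: finitely_generated_subgroup_def)
    interpret K: group "G\<lparr>carrier := K\<rparr>" by (rule subgroup_imp_group[OF sK])
    have "elementary_amenable_nat (G\<lparr>carrier := derived G K\<rparr>)"
    proof (rule finite_index_descent[OF K(1)])
      show "elementary_amenable_nat (G\<lparr>carrier := descent_step G K (Suc n)\<rparr>)"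
        by (rule step.IH[OF K subgroup_descent_step[OF sK]])
      fix L M assume L: "subgroup L G" "L \<subseteq> K" and M: "M \<lhd> G\<lparr>carrier := L\<rparr>"
        "finite (rcosets\<^bsub>G\<lparr>carrier := L\<rparr>\<^esub> M)" "elementary_amenable_nat (G\<lparr>carrier := M\<rparr>)"
      show "elementary_amenable_nat (G\<lparr>carrier := L\<rparr>)"
        by (rule elementary_amenable_nat_extension[OF subgroup_imp_group[OF L(1)] M(1)])
          (use M in \<open>simp_all add: FactGroup_def\<close>)
    qed
    moreover have "comm_group (G\<lparr>carrier := K\<rparr> Mod derived G K)"
      using K.derived_quot_is_comm_group by (simp add: derived_consistent[OF subset_refl sK])
    ultimately show "elementary_amenable_nat (G\<lparr>carrier := K\<rparr>)"
      using elementary_amenable_nat_extension[OF K.is_group derived_subgroup_is_normal[OF sK]] by simp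
  qed
qed

section \<open>Infinite descending sequences\<close>

lemma (in group) descent_terminates_iff_no_sequence:
  "descent_terminates G 0 (carrier G) \<longleftrightarrow>
    \<not> (\<exists>S :: nat \<Rightarrow> 'a set. S 0 = carrier G \<and>
      (\<forall>n. subgroup (S n) G \<and> S (Suc n) \<subseteq> S n \<and> S n \<noteq> {\<one>} \<and>
        (\<exists>K. finitely_generated_subgroup K G \<and> K \<subseteq> S n \<and> S (Suc n) = descent_step G K (Suc n))))"
    (is "_ \<longleftrightarrow> \<not> ?sequence")
proof
  assume G_term: "descent_terminates G 0 (carrier G)"
  have "\<not> (S n = T \<and> (\<forall>k \<ge> n. S k \<noteq> {\<one>} \<and>
      (\<exists>K. finitely_generated_subgroup K G \<and> K \<subseteq> S k \<and> S (Suc k) = descent_step G K (Suc k))))"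
    if "descent_terminates G n T" for n T and S :: "nat \<Rightarrow> 'a set"
    using that
  proof induction
    case (trivial n)
    then show ?case by auto
  next
    case (step T n)
    show ?case
    proof
      assume S: "S n = T \<and> (\<forall>k \<ge> n. S k \<noteq> {\<one>} \<and>
        (\<exists>K. finitely_generated_subgroup K G \<and> K \<subseteq> S k \<and> S (Suc k) = descent_step G K (Suc k)))"
      then obtain K where K: "finitely_generated_subgroup K G" "K \<subseteq> T"
          "S (Suc n) = descent_step G K (Suc n)"
        by blast
      from step.IH[OF K(1,2)] K(3) S show False
        by simp
    qed
  qed
  from this[OF G_term] show "\<not> ?sequence"
    by blast
next
  assume no_seq: "\<not> ?sequence"
  show "descent_terminates G 0 (carrier G)"
  proof (rule ccontr)
    assume not_term: "\<not> descent_terminates G 0 (carrier G)"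
    \<comment> \<open>The clause for \<open>n = 0\<close> pins down the start of the sequence, which dependent choice leaves open.\<close>
    define P where "P = (\<lambda>n T. subgroup T G \<and> \<not> descent_terminates G n T \<and> (n = 0 \<longrightarrow> T = carrier G))"
    define R where "R = (\<lambda>n T T'. \<exists>K. finitely_generated_subgroup K G \<and> K \<subseteq> T \<and>
        T' = descent_step G K (Suc n))"
    have "\<exists>S. \<forall>n. P n (S n) \<and> R n (S n) (S (Suc n))"
    proof (rule dependent_nat_choice)
      show "\<exists>T. P 0 T"
        using not_term subgroup_self by (auto simp: P_def)
      fix T n assume "P n T"
      then have T: "subgroup T G" "\<not> descent_terminates G n T"
        by (simp_all add: P_def)
      then obtain K where K: "finitely_generated_subgroup K G" "K \<subseteq> T"
          "\<not> descent_terminates G (Suc n) (descent_step G K (Suc n))"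
        using descent_terminates.step[of G T n] by blast
      then have "P (Suc n) (descent_step G K (Suc n))"
        by (simp add: P_def finitely_generated_subgroup_def subgroup_descent_step)
      then show "\<exists>T'. P (Suc n) T' \<and> R n T T'"
        using K(1,2) by (auto simp: R_def)
    qed
    then obtain S where S: "\<And>n. P n (S n)" "\<And>n. R n (S n) (S (Suc n))"
      by blast
    have "S (Suc n) \<subseteq> S n" for n
      using S(2)[of n] descent_step_le by (fastforce simp: R_def finitely_generated_subgroup_def)
    moreover have "S n \<noteq> {\<one>}" for n
      using S(1)[of n] descent_terminates.trivial[of G n] by (auto simp: P_def)
    moreover have "subgroup (S n) G" "S 0 = carrier G" for n
      using S(1) by (simp_all add: P_def)
    moreover note S(2)[unfolded R_def]
    ultimately have ?sequence
      by (intro exI[of _ S] conjI allI)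
    with no_seq show False ..
  qed
qed

lemma elementary_amenable_iff_descent_terminates:
  assumes "group G" "countable (carrier G)"
  shows "elementary_amenable G \<longleftrightarrow> descent_terminates G 0 (carrier G)"
proof
  assume "elementary_amenable G"
  then obtain H :: "nat monoid" where H: "elementary_amenable_nat H" "G \<cong> H"
    by (auto simp: elementary_amenable_def)
  have "group H"
    by (rule elementary_amenable_nat_group[OF H(1)])
  then show "descent_terminates G 0 (carrier G)"
    using iso_descent_terminates[OF _ assms(1) group.iso_sym[OF assms(1) H(2)]]
      elementary_amenable_nat_descent_terminates[OF H(1)] by blast
next
  assume G_term: "descent_terminates G 0 (carrier G)"
  obtain H :: "nat monoid" where H: "group H" "G \<cong> H"
    using group.ex_nat_copy[OF assms] .
  have "elementary_amenable_nat (H\<lparr>carrier := carrier H\<rparr>)"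
    by (rule descent_terminates_imp_elementary_amenable_nat[OF H(1)
          iso_descent_terminates[OF assms(1) H G_term] group.subgroup_self[OF H(1)]])
  then show "elementary_amenable G"
    using H(2) assms(1) by (auto simp: elementary_amenable_def)
qed

theorem theorem1p2:
  fixes G :: "('a, 'b) monoid_scheme"
  assumes "group G" and "countable (carrier G)"
  shows "elementary_amenable G \<longleftrightarrow>
    \<not> (\<exists>S :: nat \<Rightarrow> 'a set.
          S 0 = carrier G \<and>
          (\<forall>n. subgroup (S n) G \<and> S (Suc n) \<subseteq> S n \<and> S n \<noteq> {\<one>\<^bsub>G\<^esub>} \<and>
               (\<exists>K. finitely_generated_subgroup K G \<and> K \<subseteq> S n \<and>
                    S (Suc n) = derived G K \<inter> normal_index_Inter G K (n + 1))))"
  unfolding elementary_amenable_iff_descent_terminates[OF assms]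
    group.descent_terminates_iff_no_sequence[OF assms(1)] descent_step_def Suc_eq_plus1 ..

end
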